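(* Let $\varOmega\subset\mathbb{R}^d$ be an open set with finite Lebesgue measure $M>0$ and let $K\subset\mathbb{R}^d$ be compact. For each $l\in\mathbb{N}$ let $\varOmega^l_1,\dots,\varOmega^l_{n(l)}$ be pairwise disjoint open subsets of $\varOmega$ with $\bigcup_{i=1}^{n(l)}\overline{\varOmega^l_i}=\overline{\varOmega}$, and let $$u^l:=\sum_{i=1}^{n(l)}u^l_i\,\chi_{\varOmega^l_i}\colon\varOmega\to K,$$ where each $u^l_i\colon\varOmega^l_i\to K$ is injective with open image $u^l_i(\varOmega^l_i)$, has a continuously differentiable inverse $(u^l_i)^{-1}\colon u^l_i(\varOmega^l_i)\to\varOmega^l_i$ with Jacobian determinant $J_{(u^l_i)^{-1}}$, and satisfies $\overline{u^l_i(\varOmega^l_i)}=K$. Put $$g^l(y)=\frac1M\sum_{i=1}^{n(l)}\bigl|J_{(u^l_i)^{-1}}(y)\bigr|,\qquad y\in K,$$ where $J_{(u^l_i)^{-1}}$ is set equal to $0$ on $K\setminus u^l_i(\varOmega^l_i)$, and let $\nu^l$ be the homogeneous Young measure associated with $u^l$, which has density $g^l$ with respect to Lebesgue measure on $K$, i.e. $\nu^l(A)=\int_A g^l(y)\,dy$ for every Borel $A\subseteq K$. Then the sequence $(g^l)_{l\in\mathbb{N}}$ converges weakly in $L^1(K)$ to some function $h\in L^1(K)$ if and only if the sequence $(\nu^l)_{l\in\mathbb{N}}$ converges weakly in the Banach space $\mathrm{rca}(K)$ to some measure $\eta\in\mathrm{rca}(K)$.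
   Context: $\mathrm{rca}(K)$ is the Banach space of regular, countably additive scalar Borel measures on $K$ with the total variation norm. Weak convergence of measures here means convergence in the weak topology of this Banach space (tested against all bounded linear functionals on $\mathrm{rca}(K)$), not convergence tested only against continuous functions on $K$. $L^1(K)$ is taken with respect to Lebesgue measure $dy$ on $K$, and weak convergence of $g^l$ to $h$ in $L^1(K)$ means $\int_K g^l\varphi\,dy\to\int_K h\varphi\,dy$ for all $\varphi\in L^\infty(K)$. The homogeneous Young measure associated with a measurable function $u\colon\varOmega\to K$ is the Borel probability measure $\nu$ on $K$ satisfying $\int_K\beta\,d\nu=\frac1M\int_\varOmega\beta(u(x))\,dx$ for all continuous $\beta\colon K\to\mathbb{R}$. That the homogeneous Young measure $\nu^l$ associated with $u^l$ is absolutely continuous with density $g^l$ is a previously known fact, and is to be taken as given in this statement. *)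

theory Defs
  imports "HOL-Analysis.Analysis" "HOL-Probability.Probability_Measure"
begin

section \<open>The Banach space of regular countably additive measures\<close>

text \<open>Scalar (here: real) measures on \<open>K\<close> are represented by real set functions defined on the
  Borel subsets of \<open>K\<close>. As HOL functions are total, their value is fixed to be \<open>0\<close> on all other
  sets, so that equality of set functions is equality of measures. The library function
  \<^const>\<open>measure\<close> follows the same convention, so a finite Borel measure \<open>N\<close> on \<open>K\<close> is the element
  \<open>measure N\<close> of this space.\<close>

abbreviation borel_on :: "'a::topological_space set \<Rightarrow> 'a measure" where
  "borel_on K \<equiv> restrict_space borel K"

definition total_variation :: "'a::topological_space set \<Rightarrow> ('a set \<Rightarrow> real) \<Rightarrow> ennreal" where
  "total_variation K \<mu> =
     (SUP P\<in>{P. finite P \<and> disjoint P \<and> P \<subseteq> sets (borel_on K)}. \<Sum>A\<in>P. ennreal \<bar>\<mu> A\<bar>)"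

definition signed_countably_additive :: "'a::topological_space set \<Rightarrow> ('a set \<Rightarrow> real) \<Rightarrow> bool" where
  "signed_countably_additive K \<mu> \<longleftrightarrow>
     (\<forall>A :: nat \<Rightarrow> 'a set. range A \<subseteq> sets (borel_on K) \<longrightarrow> disjoint_family A \<longrightarrow>
        (\<lambda>i. \<mu> (A i)) sums \<mu> (\<Union>i. A i))"

text \<open>Regularity in the sense of Dunford and Schwartz; open and closed are relative to \<open>K\<close>.\<close>

definition regular_set_function :: "'a::topological_space set \<Rightarrow> ('a set \<Rightarrow> real) \<Rightarrow> bool" where
  "regular_set_function K \<mu> \<longleftrightarrow>
     (\<forall>E\<in>sets (borel_on K). \<forall>\<epsilon>>0. \<exists>F G.
        closedin (top_of_set K) F \<and> openin (top_of_set K) G \<and> F \<subseteq> E \<and> E \<subseteq> G \<and>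
        (\<forall>C\<in>sets (borel_on K). C \<subseteq> G - F \<longrightarrow> \<bar>\<mu> C\<bar> < \<epsilon>))"

text \<open>Finiteness of the total variation is automatic for a countably additive real set function on a
  \<open>\<sigma>\<close>-algebra; it is listed so that \<open>rca_norm\<close> is visibly a genuine real number.\<close>

definition rca :: "'a::topological_space set \<Rightarrow> ('a set \<Rightarrow> real) set" where
  "rca K = {\<mu>. (\<forall>A. A \<notin> sets (borel_on K) \<longrightarrow> \<mu> A = 0) \<and>
     signed_countably_additive K \<mu> \<and> total_variation K \<mu> < \<infinity> \<and> regular_set_function K \<mu>}"

definition rca_norm :: "'a::topological_space set \<Rightarrow> ('a set \<Rightarrow> real) \<Rightarrow> real" where
  "rca_norm K \<mu> = enn2real (total_variation K \<mu>)"

definition rca_dual :: "'a::topological_space set \<Rightarrow> (('a set \<Rightarrow> real) \<Rightarrow> real) set" where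
  "rca_dual K = {F.
     (\<forall>\<mu>\<in>rca K. \<forall>\<nu>\<in>rca K. F (\<lambda>A. \<mu> A + \<nu> A) = F \<mu> + F \<nu>) \<and>
     (\<forall>c. \<forall>\<mu>\<in>rca K. F (\<lambda>A. c * \<mu> A) = c * F \<mu>) \<and>
     (\<exists>C. \<forall>\<mu>\<in>rca K. \<bar>F \<mu>\<bar> \<le> C * rca_norm K \<mu>)}"

definition weakly_converges_rca ::
    "'a::topological_space set \<Rightarrow> (nat \<Rightarrow> 'a set \<Rightarrow> real) \<Rightarrow> ('a set \<Rightarrow> real) \<Rightarrow> bool" where
  "weakly_converges_rca K \<mu> \<eta> \<longleftrightarrow>
     (\<forall>l. \<mu> l \<in> rca K) \<and> \<eta> \<in> rca K \<and> (\<forall>F\<in>rca_dual K. (\<lambda>l. F (\<mu> l)) \<longlonglongrightarrow> F \<eta>)"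


section \<open>Weak convergence in \<open>L\<^sup>1\<close>\<close>

text \<open>Elements of \<open>L\<^sup>1\<close> and \<open>L\<^sup>\<infinity>\<close> are given by representatives; every notion below is invariant
  under changes on null sets.\<close>

definition L1 :: "'a::euclidean_space set \<Rightarrow> ('a \<Rightarrow> real) set" where
  "L1 K = {f. integrable (lebesgue_on K) f}"

definition Linfty :: "'a::euclidean_space set \<Rightarrow> ('a \<Rightarrow> real) set" where
  "Linfty K = {\<phi>. \<phi> \<in> borel_measurable (lebesgue_on K) \<and>
     (\<exists>C. AE y in lebesgue_on K. \<bar>\<phi> y\<bar> \<le> C)}"

definition weakly_converges_L1 ::
    "'a::euclidean_space set \<Rightarrow> (nat \<Rightarrow> 'a \<Rightarrow> real) \<Rightarrow> ('a \<Rightarrow> real) \<Rightarrow> bool" where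
  "weakly_converges_L1 K g h \<longleftrightarrow>
     (\<forall>l. g l \<in> L1 K) \<and> h \<in> L1 K \<and>
     (\<forall>\<phi>\<in>Linfty K. (\<lambda>l. LINT y|lebesgue_on K. g l y * \<phi> y)
        \<longlonglongrightarrow> (LINT y|lebesgue_on K. h y * \<phi> y))"


section \<open>Homogeneous Young measures and Jacobians\<close>

text \<open>The values of \<open>u\<close> need to lie in \<open>K\<close> only almost everywhere: a sum
  \<open>\<Sum>i. u\<^sub>i \<chi>\<^bsub>\<Omega>\<^sub>i\<^esub>\<close> vanishes off \<open>\<Union>i. \<Omega>\<^sub>i\<close>, and \<open>0\<close> need not belong to \<open>K\<close>.\<close>

definition homogeneous_Young_measure ::
    "'a::euclidean_space set \<Rightarrow> 'a set \<Rightarrow> ('a \<Rightarrow> 'a) \<Rightarrow> 'a measure \<Rightarrow> bool" where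
  "homogeneous_Young_measure \<Omega> K u \<nu> \<longleftrightarrow>
     u \<in> borel_measurable (lebesgue_on \<Omega>) \<and> (AE x in lebesgue_on \<Omega>. u x \<in> K) \<and>
     prob_space \<nu> \<and> sets \<nu> = sets (borel_on K) \<and>
     (\<forall>\<beta> :: 'a \<Rightarrow> real. continuous_on K \<beta> \<longrightarrow>
        (LINT y|\<nu>. \<beta> y) = (1 / measure lebesgue \<Omega>) * (LINT x|lebesgue_on \<Omega>. \<beta> (u x)))"

definition continuously_differentiable_on ::
    "((real^'n) \<Rightarrow> (real^'n)) \<Rightarrow> (real^'n) set \<Rightarrow> bool" where
  "continuously_differentiable_on f U \<longleftrightarrow>
     (\<forall>y\<in>U. f differentiable (at y)) \<and> continuous_on U (\<lambda>y. jacobian f (at y))"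

text \<open>Jacobian determinant of the inverse of \<open>v\<close> restricted to \<open>D\<close>, extended by \<open>0\<close> off \<open>v ` D\<close>.\<close>

definition inverse_Jacobian :: "(real^'n) set \<Rightarrow> ((real^'n) \<Rightarrow> (real^'n)) \<Rightarrow> (real^'n) \<Rightarrow> real" where
  "inverse_Jacobian D v y =
     (if y \<in> v ` D then det (jacobian (the_inv_into D v) (at y)) else 0)"

end

theory Submission
  imports Defs
begin

text \<open>
  The map \<open>T\<close> sending \<open>f \<in> L\<^sup>1(K)\<close> to the measure with density \<open>f\<close> is linear and norm-decreasing into
  \<open>rca(K)\<close>, and \<open>\<nu>\<^sup>l = T g\<^sup>l\<close>. Hence a functional on \<open>rca(K)\<close> composed with \<open>T\<close> is a functional on
  \<open>L\<^sup>1(K)\<close>, represented by some \<open>\<phi> \<in> L\<^sup>\<infinity>(K)\<close>; this carries weak convergence from \<open>L\<^sup>1(K)\<close> to \<open>rca(K)\<close>.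
  Conversely, evaluation at a Borel set is a functional on \<open>rca(K)\<close>, so \<open>\<nu>\<^sup>l(A) \<rightarrow> \<eta>(A)\<close> for every Borel
  \<open>A\<close>. Thus \<open>\<eta>\<close> is nonnegative and vanishes on null sets, and has a density \<open>h\<close>. As the masses of the
  \<open>\<nu>\<^sup>l\<close> are bounded, convergence tested on indicators extends to uniform limits of simple functions,
  that is, to all of \<open>L\<^sup>\<infinity>(K)\<close>.
\<close>

section \<open>Radon-Nikodym densities and the dual of L1 over a finite measure\<close>

text \<open>Since \<open>m\<close> is real-valued, it is the value function of a finite measure
  \<open>N\<close>. The condition on null sets is absolute continuity of \<open>N\<close> with
  respect to \<open>M\<close>, so the Radon-Nikodym theorem applies.\<close>

lemma (in finite_measure) density_of_countably_additive:
  fixes m :: "'a set \<Rightarrow> real"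
  assumes nonneg: "\<And>A. A \<in> sets M \<Longrightarrow> 0 \<le> m A"
    and sums: "\<And>A :: nat \<Rightarrow> 'a set. range A \<subseteq> sets M \<Longrightarrow> disjoint_family A \<Longrightarrow>
      (\<lambda>i. m (A i)) sums m (\<Union>i. A i)"
    and null: "\<And>A. A \<in> null_sets M \<Longrightarrow> m A = 0"
  obtains h where "integrable M h"
    and "\<And>A. A \<in> sets M \<Longrightarrow> m A = (LINT x|M. indicator A x * h x)"
proof -
  define N where "N = measure_of (space M) (sets M) (\<lambda>A. ennreal (m A))"
  have em: "emeasure N A = ennreal (m A)" if "A \<in> sets M" for A
    unfolding N_def
  proof (rule emeasure_measure_of[where \<Omega> = "space M" and A = "sets M"])
    show "positive (sets (measure_of (space M) (sets M) (\<lambda>A. ennreal (m A)))) (\<lambda>A. ennreal (m A))"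
      using null[of "{}"] by (simp add: positive_def)
    show "countably_additive (sets (measure_of (space M) (sets M) (\<lambda>A. ennreal (m A)))) (\<lambda>A. ennreal (m A))"
      unfolding countably_additive_def
    proof (intro allI impI)
      fix A :: "nat \<Rightarrow> 'a set"
      assume A: "range A \<subseteq> sets (measure_of (space M) (sets M) (\<lambda>A. ennreal (m A)))"
        and d: "disjoint_family A"
      from A have A': "range A \<subseteq> sets M" by simp
      have "(\<lambda>i. m (A i)) sums m (\<Union>i. A i)" by (rule sums[OF A' d])
      moreover have "0 \<le> m (A i)" for i using A' nonneg by auto
      ultimately show "(\<Sum>i. ennreal (m (A i))) = ennreal (m (\<Union> (range A)))"
        by (metis suminf_ennreal2 sums_iff)
    qed
  qed (use that sets.space_closed in auto)
  have sets_N: "sets N = sets M" by (simp add: N_def)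
  have space_N: "space N = space M" by (simp add: N_def space_measure_of_conv)
  interpret N: finite_measure N
    by standard (simp add: space_N em)
  have "absolutely_continuous M N"
    using null by (auto simp: absolutely_continuous_def null_sets_def sets_N em)
  then obtain f where f: "f \<in> borel_measurable M" and fN: "density M f = N"
    using Radon_Nikodym_finite_measure[OF N.finite_measure_axioms sets_N] by blast
  \<comment> \<open>The total mass \<open>m (space M)\<close> is finite, so \<open>f\<close> is
    infinite only on a null set and passing to real values changes it only there.\<close>
  define h where "h x = enn2real (f x)" for x
  have h[measurable]: "h \<in> borel_measurable M" unfolding h_def using f by measurable
  have h0: "0 \<le> h x" for x by (simp add: h_def)
  have fin: "(\<integral>\<^sup>+ x. f x \<partial>M) = ennreal (m (space M))"
    using emeasure_density[OF f sets.top] em[OF sets.top]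
    by (simp add: fN cong: nn_integral_cong)
  then have "AE x in M. f x \<noteq> \<infinity>"
    by (intro nn_integral_PInf_AE) (use f in auto)
  then have fh: "AE x in M. f x = ennreal (h x)"
    by eventually_elim (simp add: h_def less_top)
  have Nh: "N = density M (\<lambda>x. ennreal (h x))"
    unfolding fN[symmetric] by (rule density_cong) (use f fh in auto)
  have int: "integrable M h"
  proof (rule integrableI_nonneg)
    show "(\<integral>\<^sup>+ x. ennreal (h x) \<partial>M) < \<infinity>"
      using fin nn_integral_cong_AE[OF fh] by simp
  qed (use h0 in auto)
  show thesis
  proof (rule that[OF int])
    fix A assume A: "A \<in> sets M"
    have "m A = measure N A" using em[OF A] nonneg[OF A] by (simp add: measure_def)
    also have "\<dots> = (LINT x|N. indicator A x)" using A sets_N by simp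
    also have "\<dots> = (LINT x|M. h x * indicator A x)"
      unfolding Nh by (rule integral_real_density) (use A h0 in auto)
    finally show "m A = (LINT x|M. indicator A x * h x)" by (simp add: mult.commute)
  qed
qed

text \<open>Indicators are integrable because \<open>M\<close> is finite, so \<open>L\<close>
  restricted to them is a signed measure dominated by \<open>C\<close> times \<open>M\<close>. Its
  density is \<open>\<phi>\<close>. The representation spreads from indicators to all integrable
  functions because both sides are linear and continuous along dominated limits.\<close>

lemma (in finite_measure) L1_functional_eq_integral:
  fixes L :: "('a \<Rightarrow> real) \<Rightarrow> real"
  assumes add: "\<And>f g. integrable M f \<Longrightarrow> integrable M g \<Longrightarrow> L (\<lambda>x. f x + g x) = L f + L g"
    and scale: "\<And>c f. integrable M f \<Longrightarrow> L (\<lambda>x. c * f x) = c * L f"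
    and bound: "\<And>f. integrable M f \<Longrightarrow> \<bar>L f\<bar> \<le> C * (LINT x|M. \<bar>f x\<bar>)"
  obtains \<phi> where "\<phi> \<in> borel_measurable M" and "AE x in M. \<bar>\<phi> x\<bar> \<le> C"
    and "\<And>f. integrable M f \<Longrightarrow> L f = (LINT x|M. f x * \<phi> x)"
proof -
  have ind: "integrable M (indicator A :: 'a \<Rightarrow> real)" if "A \<in> sets M" for A
    using that by (simp add: emeasure_eq_measure)
  have bound_ind: "\<bar>L (indicator A)\<bar> \<le> C * measure M A" if "A \<in> sets M" for A
    using bound[OF ind[OF that]] that by simp
  have diff: "L (\<lambda>x. f x - g x) = L f - L g" if f: "integrable M f" and g: "integrable M g" for f g
  proof -
    have "L (\<lambda>x. f x + (- 1) * g x) = L f + (- 1) * L g"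
      by (subst add) (use f g scale[OF g, of "- 1"] in auto)
    then show ?thesis by simp
  qed
  have L0: "L (\<lambda>x. 0) = 0" using bound[of "\<lambda>x. 0"] by simp
  have L_sum: "L (\<lambda>x. \<Sum>i<n. f i x) = (\<Sum>i<n. L (f i))" if "\<And>i. integrable M (f i)" for f :: "nat \<Rightarrow> 'a \<Rightarrow> real" and n
    by (induction n) (simp_all add: L0 add that)
  \<comment> \<open>Adding \<open>C\<close> times the measure makes the set function nonnegative, so that the Radon-Nikodym
    theorem for positive measures applies.\<close>
  define m where "m A = L (indicator A) + C * measure M A" for A
  obtain h where h: "integrable M h"
    and mh: "\<And>A. A \<in> sets M \<Longrightarrow> m A = (LINT x|M. indicator A x * h x)"
  proof (rule density_of_countably_additive[of m])
    show "0 \<le> m A" if "A \<in> sets M" for A using bound_ind[OF that] by (simp add: m_def)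
    show "m A = 0" if "A \<in> null_sets M" for A
      using bound_ind[of A] that by (auto simp: m_def measure_def null_sets_def)
    fix A :: "nat \<Rightarrow> 'a set"
    assume A: "range A \<subseteq> sets M" and d: "disjoint_family A"
    let ?U = "\<Union>i. A i"
    have Ai: "A i \<in> sets M" for i using A by auto
    have U: "?U \<in> sets M" using Ai by auto
    note ms = finite_measure_UNION[OF A d]
    \<comment> \<open>The remainder \<open>?r\<close> after \<open>n\<close> terms is the indicator
      of the union of the \<open>A i\<close> with \<open>n \<le> i\<close>. Hence its image under
      \<open>L\<close> is at most \<open>C\<close> times the tail of a convergent series of
      measures.\<close>
    have "(\<lambda>i. L (indicator (A i))) sums L (indicator ?U)"
      unfolding sums_def
    proof (rule LIM_zero_cancel, rule Lim_null_comparison)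
      show "(\<lambda>n. C * (measure M ?U - (\<Sum>i<n. measure M (A i)))) \<longlonglongrightarrow> 0"
        using ms unfolding sums_def
        by (auto intro!: tendsto_eq_intros)
      show "\<forall>\<^sub>F n in sequentially. norm ((\<Sum>i<n. L (indicator (A i))) - L (indicator ?U))
          \<le> C * (measure M ?U - (\<Sum>i<n. measure M (A i)))"
      proof (rule always_eventually, rule allI)
        fix n
        let ?r = "\<lambda>x. indicator ?U x - (\<Sum>i<n. indicator (A i) x) :: real"
        have r: "?r x = indicator (\<Union>i\<in>{n..}. A i) x" for x
        proof -
          have "(\<Sum>i<n. indicator (A i) x :: real) = indicator (\<Union>i<n. A i) x"
            using d by (subst indicator_UN_disjoint) (auto simp: disjoint_family_on_def)
          moreover have "UNIV = {..<n} \<union> {n..}" by auto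
          then have "?U = (\<Union>i<n. A i) \<union> (\<Union>i\<in>{n..}. A i)" by (metis UN_Un)
          moreover have "A i \<inter> A j = {}" if "i < n" "n \<le> j" for i j
            using disjoint_family_onD[OF d, of i j] that by simp
          then have "(\<Union>i<n. A i) \<inter> (\<Union>i\<in>{n..}. A i) = {}"
            by blast
          ultimately show ?thesis by (simp add: indicator_add[symmetric])
        qed
        have "L ?r = L (indicator ?U) - (\<Sum>i<n. L (indicator (A i)))"
          by (subst diff) (use ind U Ai in \<open>auto simp: L_sum\<close>)
        then have "norm ((\<Sum>i<n. L (indicator (A i))) - L (indicator ?U)) = \<bar>L ?r\<bar>" by simp
        also have "\<dots> \<le> C * (LINT x|M. \<bar>?r x\<bar>)"
          by (rule bound) (use ind U Ai in auto)
        also have "(LINT x|M. \<bar>?r x\<bar>) = (LINT x|M. ?r x)"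
          by (intro Bochner_Integration.integral_cong refl) (simp add: r)
        also have "\<dots> = measure M ?U - (\<Sum>i<n. measure M (A i))"
          by (subst Bochner_Integration.integral_diff) (use ind U Ai in auto)
        finally show "norm ((\<Sum>i<n. L (indicator (A i))) - L (indicator ?U))
            \<le> C * (measure M ?U - (\<Sum>i<n. measure M (A i)))" .
      qed
    qed
    then show "(\<lambda>i. m (A i)) sums m ?U"
      unfolding m_def by (intro sums_add sums_mult ms)
  qed blast
  \<comment> \<open>Subtracting \<open>C\<close> undoes the shift made in \<open>m\<close>.\<close>
  define \<phi> where "\<phi> x = h x - C" for x
  have \<phi>: "integrable M \<phi>" using h by (simp add: \<phi>_def [abs_def])
  have L_ind: "L (indicator A) = (LINT x|M. indicator A x * \<phi> x)" if A: "A \<in> sets M" for A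
  proof -
    have "(LINT x|M. indicator A x * \<phi> x) = (LINT x|M. indicator A x * h x - indicator A x * C)"
      by (simp add: \<phi>_def algebra_simps)
    also have "\<dots> = m A - C * measure M A"
      using A integrable_mult_indicator[OF A h] ind[OF A] mh[OF A] by simp
    finally show ?thesis by (simp add: m_def)
  qed
  \<comment> \<open>The two-sided estimate \<open>bound_ind\<close> says that
    \<open>C - \<phi>\<close> and \<open>C + \<phi>\<close> have nonnegative integral over every
    measurable set. A function with this property is nonnegative almost everywhere.\<close>
  have up: "AE x in M. 0 \<le> C - \<phi> x"
  proof (rule density_nonneg)
    fix A assume A: "A \<in> sets M"
    have "set_lebesgue_integral M A (\<lambda>x. C - \<phi> x) = (LINT x|M. indicator A x * C - indicator A x * \<phi> x)"
      by (simp add: set_lebesgue_integral_def algebra_simps)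
    also have "\<dots> = C * measure M A - L (indicator A)"
      using A integrable_mult_indicator[OF A \<phi>] ind[OF A] L_ind[OF A] by simp
    finally show "0 \<le> set_lebesgue_integral M A (\<lambda>x. C - \<phi> x)" using bound_ind[OF A] by simp
  qed (use \<phi> in auto)
  have lo: "AE x in M. 0 \<le> C + \<phi> x"
  proof (rule density_nonneg)
    fix A assume A: "A \<in> sets M"
    have "set_lebesgue_integral M A (\<lambda>x. C + \<phi> x) = (LINT x|M. indicator A x * C + indicator A x * \<phi> x)"
      by (simp add: set_lebesgue_integral_def algebra_simps)
    also have "\<dots> = C * measure M A + L (indicator A)"
      using A integrable_mult_indicator[OF A \<phi>] ind[OF A] L_ind[OF A] by simp
    finally show "0 \<le> set_lebesgue_integral M A (\<lambda>x. C + \<phi> x)" using bound_ind[OF A] by simp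
  qed (use \<phi> in auto)
  have bd: "AE x in M. \<bar>\<phi> x\<bar> \<le> C" using up lo by eventually_elim auto
  have meas: "\<phi> \<in> borel_measurable M" using \<phi> by auto
  have int_mult: "integrable M (\<lambda>x. f x * \<phi> x)" if "integrable M f" for f
  proof (rule Bochner_Integration.integrable_bound)
    show "integrable M (\<lambda>x. C * f x)" using that by simp
    show "AE x in M. norm (f x * \<phi> x) \<le> norm (C * f x)"
      using bd by eventually_elim (auto simp: abs_mult mult.commute[of C] intro!: mult_left_mono)
  qed (use that meas in auto)
  show thesis
  proof (rule that[OF meas bd])
    fix f :: "'a \<Rightarrow> real" assume "integrable M f"
    then show "L f = (LINT x|M. f x * \<phi> x)"
    proof (induct f rule: integrable_induct)
      case (base A c)
      then show ?case
        using scale[OF ind[OF base(1)], of c] L_ind[OF base(1)]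
        by (simp add: mult.commute[of _ c] mult.assoc)
    next
      case (add f g)
      then show ?case by (simp add: assms(1) int_mult distrib_right)
    next
      case (lim f s)
      have "(\<lambda>i. L (s i)) \<longlonglongrightarrow> L f"
      proof (rule LIM_zero_cancel, rule Lim_null_comparison)
        \<comment> \<open>The approximants satisfy
          \<open>\<bar>s i x\<bar> \<le> 2 * \<bar>f x\<bar>\<close>, which gives the factor 3 for
          the difference. Convergence in the L1 norm is what \<open>bound\<close> needs.\<close>
        have "(\<lambda>i. LINT x|M. \<bar>s i x - f x\<bar>) \<longlonglongrightarrow> (LINT x|M. 0)"
        proof (rule integral_dominated_convergence[where w = "\<lambda>x. 3 * \<bar>f x\<bar>"])
          show "AE x in M. (\<lambda>i. \<bar>s i x - f x\<bar>) \<longlonglongrightarrow> 0"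
            by (intro AE_I2 tendsto_rabs_zero LIM_zero lim(3))
          show "AE x in M. norm \<bar>s i x - f x\<bar> \<le> 3 * \<bar>f x\<bar>" for i
          proof (rule AE_I2)
            fix x assume "x \<in> space M"
            from lim(4)[OF this, of i] show "norm \<bar>s i x - f x\<bar> \<le> 3 * \<bar>f x\<bar>" by simp
          qed
        qed (use lim(1,5) in auto)
        then show "(\<lambda>i. C * (LINT x|M. \<bar>s i x - f x\<bar>)) \<longlonglongrightarrow> 0"
          by (auto intro!: tendsto_eq_intros)
        have "norm (L (s i) - L f) \<le> C * (LINT x|M. \<bar>s i x - f x\<bar>)" for i
          using bound[of "\<lambda>x. s i x - f x"] lim(1,5) by (simp add: diff)
        then show "\<forall>\<^sub>F i in sequentially. norm (L (s i) - L f) \<le> C * (LINT x|M. \<bar>s i x - f x\<bar>)"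
          by simp
      qed
      moreover have "(\<lambda>i. L (s i)) \<longlonglongrightarrow> (LINT x|M. f x * \<phi> x)"
        unfolding lim(2)
      proof (rule integral_dominated_convergence[where w = "\<lambda>x. 2 * \<bar>f x * \<phi> x\<bar>"])
        show "AE x in M. (\<lambda>i. s i x * \<phi> x) \<longlonglongrightarrow> f x * \<phi> x"
          by (intro AE_I2 tendsto_mult tendsto_const lim(3))
        show "AE x in M. norm (s i x * \<phi> x) \<le> 2 * \<bar>f x * \<phi> x\<bar>" for i
        proof (rule AE_I2)
          fix x assume "x \<in> space M"
          from mult_right_mono[OF lim(4)[OF this, of i] abs_ge_zero[of "\<phi> x"]]
          show "norm (s i x * \<phi> x) \<le> 2 * \<bar>f x * \<phi> x\<bar>" by (simp add: abs_mult)
        qed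
      qed (use lim(1,5) int_mult meas in auto)
      ultimately show ?case by (rule LIMSEQ_unique)
    qed
  qed
qed

section \<open>Regularity and membership in the space of measures\<close>

text \<open>Inner approximation by compact sets and outer approximation by open sets each use up
  half of \<open>\<epsilon>\<close>.\<close>

lemma finite_borel_measure_approx:
  fixes N :: "'a::{second_countable_topology, complete_space} measure"
  assumes N: "finite_measure N" "sets N = sets borel" and E: "E \<in> sets borel" and "\<epsilon> > 0"
  obtains F G where "compact F" "open G" "F \<subseteq> E" "E \<subseteq> G" "measure N (G - F) < \<epsilon>"
proof -
  interpret finite_measure N by fact
  have fin: "emeasure N (space N) \<noteq> \<infinity>" by simp
  have "\<exists>F. compact F \<and> F \<subseteq> E \<and> measure N E - \<epsilon> / 2 < measure N F"
  proof (rule ccontr)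
    assume "\<not> ?thesis"
    then have le: "measure N F \<le> measure N E - \<epsilon> / 2" if "compact F" "F \<subseteq> E" for F
      using that by (meson not_le)
    have "emeasure N E \<le> ennreal (measure N E - \<epsilon> / 2)"
      unfolding inner_regular[OF N(2) fin E]
      by (rule SUP_least) (auto simp: emeasure_eq_measure intro: ennreal_leI le)
    \<comment> \<open>Nonnegativity matters: \<open>ennreal\<close> would truncate a negative number
      to 0, and the previous inequality would be no contradiction when \<open>E\<close> has measure
      0.\<close>
    moreover have "0 \<le> measure N E - \<epsilon> / 2" using le[of "{}"] by simp
    ultimately show False using \<open>\<epsilon> > 0\<close> by (simp add: emeasure_eq_measure)
  qed
  then obtain F where F: "compact F" "F \<subseteq> E" "measure N E - \<epsilon> / 2 < measure N F" by blast
  have "\<exists>G. open G \<and> E \<subseteq> G \<and> measure N G < measure N E + \<epsilon> / 2"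
  proof (rule ccontr)
    assume "\<not> ?thesis"
    then have le: "measure N E + \<epsilon> / 2 \<le> measure N G" if "open G" "E \<subseteq> G" for G
      using that by (meson not_le)
    have "ennreal (measure N E + \<epsilon> / 2) \<le> emeasure N E"
      unfolding outer_regular[OF N(2) fin E]
      by (rule INF_greatest) (auto simp: emeasure_eq_measure intro: ennreal_leI le)
    then show False using \<open>\<epsilon> > 0\<close> by (simp add: emeasure_eq_measure)
  qed
  then obtain G where G: "open G" "E \<subseteq> G" "measure N G < measure N E + \<epsilon> / 2" by blast
  have "measure N (G - F) = measure N G - measure N F"
    using F G by (intro finite_measure_Diff) (auto simp: N(2) compact_imp_closed)
  with F G show thesis by (intro that[of F G]) auto
qed

lemma abs_le_total_variation:
  assumes "A \<in> sets (borel_on K)"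
  shows "ennreal \<bar>\<mu> A\<bar> \<le> total_variation K \<mu>"
  unfolding total_variation_def
  by (rule SUP_upper2[of "{A}"]) (use assms in auto)

lemma abs_le_rca_norm:
  assumes "\<mu> \<in> rca K"
  shows "\<bar>\<mu> A\<bar> \<le> rca_norm K \<mu>"
proof (cases "A \<in> sets (borel_on K)")
  case True
  have "total_variation K \<mu> < \<infinity>" using assms by (simp add: rca_def)
  then show ?thesis
    using abs_le_total_variation[OF True, of \<mu>] unfolding rca_norm_def
    by (cases "total_variation K \<mu>") auto
next
  case False
  then have "\<mu> A = 0" using assms by (simp add: rca_def)
  then show ?thesis by (simp add: rca_norm_def)
qed

text \<open>The bound holds with constant 1, since a single set is already a competitor in the total
  variation. For a non-Borel \<open>A\<close> the functional is zero on \<open>rca K\<close> by the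
  convention on set functions.\<close>

lemma eval_in_rca_dual: "(\<lambda>\<mu>. \<mu> A) \<in> rca_dual K"
  unfolding rca_dual_def using abs_le_rca_norm[where K = K and A = A]
  by (auto intro!: exI[of _ 1])

text \<open>This is the converse of the Jordan decomposition. Everything is inherited from the two
  positive measures through the estimate of \<open>\<bar>\<mu> A\<bar>\<close> by the sum of their
  values; for regularity, one unites the inner sets and intersects the outer ones.\<close>

lemma measure_difference_rca:
  fixes N\<^sub>1 N\<^sub>2 :: "'a::{second_countable_topology, complete_space} measure"
  assumes N\<^sub>1: "finite_measure N\<^sub>1" "sets N\<^sub>1 = sets borel"
    and N\<^sub>2: "finite_measure N\<^sub>2" "sets N\<^sub>2 = sets borel"
    and K: "K \<in> sets borel"
    and off: "\<And>A. A \<notin> sets (borel_on K) \<Longrightarrow> \<mu> A = 0"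
    and diff: "\<And>A. A \<in> sets (borel_on K) \<Longrightarrow> \<mu> A = measure N\<^sub>1 A - measure N\<^sub>2 A"
  shows "\<mu> \<in> rca K" and "rca_norm K \<mu> \<le> measure N\<^sub>1 K + measure N\<^sub>2 K"
proof -
  interpret N\<^sub>1: finite_measure N\<^sub>1 by fact
  interpret N\<^sub>2: finite_measure N\<^sub>2 by fact
  have BK: "A \<in> sets (borel_on K) \<longleftrightarrow> A \<subseteq> K \<and> A \<in> sets borel" for A
    using K by (simp add: sets_restrict_space_iff)
  have abs_le: "\<bar>\<mu> A\<bar> \<le> measure N\<^sub>1 A + measure N\<^sub>2 A" if "A \<in> sets (borel_on K)" for A
    unfolding diff[OF that] by (simp add: abs_le_iff)
  have tv: "total_variation K \<mu> \<le> ennreal (measure N\<^sub>1 K + measure N\<^sub>2 K)"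
    unfolding total_variation_def
  proof (rule SUP_least)
    fix P assume "P \<in> {P. finite P \<and> disjoint P \<and> P \<subseteq> sets (borel_on K)}"
    then have P: "finite P" "disjoint P" "P \<subseteq> sets (borel_on K)" by auto
    have dis: "disjoint_family_on (\<lambda>A. A) P"
      using P(2) by (auto simp: disjoint_family_on_def disjoint_def)
    have PB: "(\<lambda>A. A) ` P \<subseteq> sets borel" using P(3) BK by auto
    have UP: "\<Union>P \<subseteq> K" using P(3) BK by auto
    have "(\<Sum>A\<in>P. \<bar>\<mu> A\<bar>) \<le> (\<Sum>A\<in>P. measure N\<^sub>1 A + measure N\<^sub>2 A)"
      using P(3) abs_le by (intro sum_mono) auto
    also have "\<dots> = measure N\<^sub>1 (\<Union>P) + measure N\<^sub>2 (\<Union>P)"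
      using N\<^sub>1.finite_measure_finite_Union[OF P(1) _ dis] N\<^sub>2.finite_measure_finite_Union[OF P(1) _ dis]
        PB N\<^sub>1(2) N\<^sub>2(2) by (simp add: sum.distrib)
    also have "\<dots> \<le> measure N\<^sub>1 K + measure N\<^sub>2 K"
      by (intro add_mono N\<^sub>1.finite_measure_mono N\<^sub>2.finite_measure_mono UP) (use K N\<^sub>1(2) N\<^sub>2(2) in auto)
    finally show "(\<Sum>A\<in>P. ennreal \<bar>\<mu> A\<bar>) \<le> ennreal (measure N\<^sub>1 K + measure N\<^sub>2 K)"
      by (simp add: ennreal_leI del: ennreal_plus)
  qed
  then show "rca_norm K \<mu> \<le> measure N\<^sub>1 K + measure N\<^sub>2 K"
    unfolding rca_norm_def by (rule enn2real_leI[rotated]) simp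
  have "signed_countably_additive K \<mu>"
    unfolding signed_countably_additive_def
  proof (intro allI impI)
    fix A :: "nat \<Rightarrow> 'a set"
    assume A: "range A \<subseteq> sets (borel_on K)" and d: "disjoint_family A"
    have U: "(\<Union>i. A i) \<in> sets (borel_on K)" and Ai: "A i \<in> sets (borel_on K)" for i
      using A by auto
    have "range A \<subseteq> sets N\<^sub>1" "range A \<subseteq> sets N\<^sub>2" using A BK N\<^sub>1(2) N\<^sub>2(2) by auto
    then show "(\<lambda>i. \<mu> (A i)) sums \<mu> (\<Union>i. A i)"
      unfolding diff[OF U] diff[OF Ai]
      by (intro sums_diff N\<^sub>1.finite_measure_UNION N\<^sub>2.finite_measure_UNION d)
  qed
  moreover have "regular_set_function K \<mu>"
    unfolding regular_set_function_def
  proof (intro ballI allI impI)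
    fix E and \<epsilon> :: real assume E: "E \<in> sets (borel_on K)" and \<epsilon>: "\<epsilon> > 0"
    then have EB: "E \<in> sets borel" and EK: "E \<subseteq> K" using BK by auto
    obtain F\<^sub>1 G\<^sub>1 where 1: "compact F\<^sub>1" "open G\<^sub>1" "F\<^sub>1 \<subseteq> E" "E \<subseteq> G\<^sub>1" "measure N\<^sub>1 (G\<^sub>1 - F\<^sub>1) < \<epsilon> / 2"
      using finite_borel_measure_approx[OF N\<^sub>1 EB] \<epsilon> by (metis half_gt_zero)
    obtain F\<^sub>2 G\<^sub>2 where 2: "compact F\<^sub>2" "open G\<^sub>2" "F\<^sub>2 \<subseteq> E" "E \<subseteq> G\<^sub>2" "measure N\<^sub>2 (G\<^sub>2 - F\<^sub>2) < \<epsilon> / 2"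
      using finite_borel_measure_approx[OF N\<^sub>2 EB] \<epsilon> by (metis half_gt_zero)
    have "\<bar>\<mu> C\<bar> < \<epsilon>" if C: "C \<in> sets (borel_on K)" and sub: "C \<subseteq> K \<inter> (G\<^sub>1 \<inter> G\<^sub>2) - (F\<^sub>1 \<union> F\<^sub>2)" for C
    proof -
      have "measure N\<^sub>1 C \<le> measure N\<^sub>1 (G\<^sub>1 - F\<^sub>1)" "measure N\<^sub>2 C \<le> measure N\<^sub>2 (G\<^sub>2 - F\<^sub>2)"
        using sub 1(1,2) 2(1,2) N\<^sub>1(2) N\<^sub>2(2)
        by (auto intro!: N\<^sub>1.finite_measure_mono N\<^sub>2.finite_measure_mono simp: compact_imp_closed)
      then show ?thesis using abs_le[OF C] 1(5) 2(5) by linarith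
    qed
    moreover have "closedin (top_of_set K) (F\<^sub>1 \<union> F\<^sub>2)"
      using 1 2 EK by (intro closed_subset) (auto simp: compact_imp_closed)
    moreover have "openin (top_of_set K) (K \<inter> (G\<^sub>1 \<inter> G\<^sub>2))"
      using 1 2 by (intro openin_open_Int) auto
    ultimately show "\<exists>F G. closedin (top_of_set K) F \<and> openin (top_of_set K) G \<and> F \<subseteq> E \<and> E \<subseteq> G \<and>
        (\<forall>C\<in>sets (borel_on K). C \<subseteq> G - F \<longrightarrow> \<bar>\<mu> C\<bar> < \<epsilon>)"
      using 1 2 EK by (intro exI[of _ "F\<^sub>1 \<union> F\<^sub>2"] exI[of _ "K \<inter> (G\<^sub>1 \<inter> G\<^sub>2)"]) auto
  qed
  moreover have "total_variation K \<mu> < \<infinity>" using tv by (rule le_less_trans) simp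
  ultimately show "\<mu> \<in> rca K" using off by (simp add: rca_def)
qed

section \<open>The embedding of L1 into the space of measures\<close>

text \<open>This is the operator \<open>T\<close> of the overview. The value 0 off the Borel sets
  matches the convention of \<open>measure\<close>, so that equality with a Young measure is an
  equality of functions on all sets.\<close>

definition density_set_function :: "'a::euclidean_space set \<Rightarrow> ('a \<Rightarrow> real) \<Rightarrow> 'a set \<Rightarrow> real" where
  "density_set_function K f A =
     (if A \<in> sets (borel_on K) then LINT y|lebesgue_on K. indicator A y * f y else 0)"

lemma sets_borel_on_imp_lebesgue_on:
  fixes K :: "'a::euclidean_space set"
  shows "A \<in> sets (borel_on K) \<Longrightarrow> A \<in> sets (lebesgue_on K)"
  by (auto simp: sets_restrict_space)

text \<open>The positive and negative parts of \<open>f\<close> are densities of finite measures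
  whose difference is the set function. Their masses add up to the L1 norm of \<open>f\<close>,
  which bounds the total variation.\<close>

lemma density_set_function_rca:
  fixes K :: "'a::euclidean_space set"
  assumes K: "K \<in> sets borel" and f: "integrable (lebesgue_on K) f"
  shows "density_set_function K f \<in> rca K"
    and "rca_norm K (density_set_function K f) \<le> (LINT y|lebesgue_on K. \<bar>f y\<bar>)"
proof -
  \<comment> \<open>The push-forward under the identity turns a measure on the trace of the Lebesgue \<open>\<sigma>\<close>-algebra on
    \<open>K\<close> into a Borel measure on the whole space, where the regularity theorem is available.\<close>
  define N where "N p = distr (density (lebesgue_on K) (\<lambda>x. ennreal (p x))) borel (\<lambda>x. x)" for p :: "'a \<Rightarrow> real"
  have sets_N: "sets (N p) = sets borel" for p by (simp add: N_def)
  have id: "(\<lambda>x. x) \<in> lebesgue_on K \<rightarrow>\<^sub>M borel"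
    by (intro measurable_restrict_space1 measurable_completion) simp
  have N: "finite_measure (N p)"
    and N_eq: "\<And>A. A \<in> sets (borel_on K) \<Longrightarrow> measure (N p) A = (LINT x|lebesgue_on K. indicator A x * p x)"
    if p: "integrable (lebesgue_on K) p" "\<And>x. 0 \<le> p x" for p
  proof -
    have [measurable]: "p \<in> borel_measurable (lebesgue_on K)" using p by auto
    have "emeasure (density (lebesgue_on K) (\<lambda>x. ennreal (p x))) K = (\<integral>\<^sup>+ x. ennreal (p x) \<partial>lebesgue_on K)"
      by (subst emeasure_density) (auto intro!: nn_integral_cong)
    also have "\<dots> = ennreal (LINT x|lebesgue_on K. p x)"
      using p by (intro nn_integral_eq_integral) auto
    finally have "finite_measure (density (lebesgue_on K) (\<lambda>x. ennreal (p x)))"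
      by (intro finite_measureI) simp
    then show "finite_measure (N p)"
      unfolding N_def by (rule finite_measure.finite_measure_distr) (use id in simp)
    fix A assume A: "A \<in> sets (borel_on K)"
    then have AK: "A \<subseteq> K" "A \<in> sets borel" using K by (auto simp: sets_restrict_space_iff)
    have AL: "A \<in> sets (lebesgue_on K)" by (rule sets_borel_on_imp_lebesgue_on[OF A])
    have "measure (N p) A = measure (density (lebesgue_on K) (\<lambda>x. ennreal (p x))) A"
      unfolding N_def using AK id by (subst measure_distr) (simp_all add: Int_absorb2[OF AK(1)])
    also have "\<dots> = (LINT x|density (lebesgue_on K) (\<lambda>x. ennreal (p x)). indicator A x)"
      using AL by (simp add: Int_absorb2[OF AK(1)])
    also have "\<dots> = (LINT x|lebesgue_on K. p x * indicator A x)"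
      using AL p(2) by (intro integral_real_density) auto
    finally show "measure (N p) A = (LINT x|lebesgue_on K. indicator A x * p x)"
      by (simp add: mult.commute)
  qed
  define p where "p x = max (f x) 0" for x
  define q where "q x = max (- f x) 0" for x
  have p: "integrable (lebesgue_on K) p" "\<And>x. 0 \<le> p x"
    and q: "integrable (lebesgue_on K) q" "\<And>x. 0 \<le> q x"
    using f by (auto simp: p_def [abs_def] q_def [abs_def])
  have off: "density_set_function K f A = 0" if "A \<notin> sets (borel_on K)" for A
    using that by (simp add: density_set_function_def)
  have on: "density_set_function K f A = measure (N p) A - measure (N q) A"
    if A: "A \<in> sets (borel_on K)" for A
  proof -
    note AL = sets_borel_on_imp_lebesgue_on[OF A]
    have "measure (N p) A - measure (N q) A
        = (LINT x|lebesgue_on K. indicator A x * p x - indicator A x * q x)"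
      using integrable_mult_indicator[OF AL p(1)] integrable_mult_indicator[OF AL q(1)]
      by (simp add: N_eq[OF p A] N_eq[OF q A])
    also have "\<dots> = density_set_function K f A"
      using A by (auto simp: density_set_function_def p_def q_def indicator_def intro!: Bochner_Integration.integral_cong)
    finally show ?thesis ..
  qed
  note rca = measure_difference_rca[OF N[OF p] sets_N N[OF q] sets_N K off on]
  show "density_set_function K f \<in> rca K" by (rule rca(1))
  have KB: "K \<in> sets (borel_on K)" using K by (simp add: sets_restrict_space_iff)
  have "rca_norm K (density_set_function K f) \<le> measure (N p) K + measure (N q) K"
    by (rule rca(2))
  also have "\<dots> = (LINT x|lebesgue_on K. p x + q x)"
    using p(1) q(1)
    by (subst N_eq[OF p KB], subst N_eq[OF q KB], subst Bochner_Integration.integral_add)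
      (auto intro!: arg_cong2[where f = "(+)"] Bochner_Integration.integral_cong)
  also have "\<dots> = (LINT y|lebesgue_on K. \<bar>f y\<bar>)"
    by (intro Bochner_Integration.integral_cong) (auto simp: p_def q_def)
  finally show "rca_norm K (density_set_function K f) \<le> (LINT y|lebesgue_on K. \<bar>f y\<bar>)" .
qed

section \<open>From indicators to bounded test functions\<close>

text \<open>A three-epsilon argument: replacing \<open>\<phi>\<close> by a simple function
  \<open>\<sigma>\<close> costs at most the L1 norm times the uniform distance, and the bound
  \<open>B\<close> makes this cost uniform in \<open>l\<close>. For \<open>\<sigma>\<close> itself,
  convergence is a finite sum of instances of \<open>conv\<close>.\<close>

lemma integral_bounded_mult_tendsto:
  fixes g :: "nat \<Rightarrow> 'a \<Rightarrow> real"
  assumes g: "\<And>l. integrable M (g l)" and h: "integrable M h"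
    and B: "\<And>l. (LINT x|M. \<bar>g l x\<bar>) \<le> B"
    and conv: "\<And>A. A \<in> sets M \<Longrightarrow>
      (\<lambda>l. LINT x|M. indicator A x * g l x) \<longlonglongrightarrow> (LINT x|M. indicator A x * h x)"
    and \<phi>: "\<phi> \<in> borel_measurable M" "AE x in M. \<bar>\<phi> x\<bar> \<le> C"
  shows "(\<lambda>l. LINT x|M. g l x * \<phi> x) \<longlonglongrightarrow> (LINT x|M. h x * \<phi> x)"
proof (rule tendstoI)
  fix \<epsilon> :: real assume "\<epsilon> > 0"
  \<comment> \<open>On a null space \<open>C\<close> may be negative, and clipping to the interval
    from \<open>- D\<close> to \<open>D\<close> needs \<open>0 \<le> D\<close>. The clipped function
    \<open>\<psi>\<close> is bounded everywhere, not just almost everywhere.\<close>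
  define D where "D = max C 0"
  define \<psi> where "\<psi> x = max (- D) (min D (\<phi> x))" for x
  have D: "0 \<le> D" by (simp add: D_def)
  have \<psi>m[measurable]: "\<psi> \<in> borel_measurable M" unfolding \<psi>_def using \<phi>(1) by measurable
  have \<psi>D: "- D \<le> \<psi> x" "\<psi> x \<le> D" for x using D by (auto simp: \<psi>_def)
  have \<phi>\<psi>: "AE x in M. \<phi> x = \<psi> x" using \<phi>(2) by eventually_elim (auto simp: \<psi>_def D_def)
  define H where "H = (LINT x|M. \<bar>h x\<bar>)"
  have H0: "0 \<le> H" unfolding H_def by simp
  have B0: "0 \<le> B" using B[of 0] by (rule order_trans[rotated]) simp
  \<comment> \<open>The mesh \<open>1 / k\<close> must make both \<open>B / k\<close> and
    \<open>H / k\<close> smaller than a third of \<open>\<epsilon>\<close>. The summand 1 forces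
    \<open>k\<close> to be positive even if \<open>B\<close> and \<open>H\<close> vanish.\<close>
  obtain k :: nat where k: "3 * (B + H + 1) / \<epsilon> < real k" using reals_Archimedean2 by blast
  moreover have "0 < 3 * (B + H + 1) / \<epsilon>" using H0 B0 \<open>\<epsilon> > 0\<close> by simp
  ultimately have k0: "0 < real k" by linarith
  have kB: "B / k < \<epsilon> / 3" and kH: "H / k < \<epsilon> / 3"
    using k k0 \<open>\<epsilon> > 0\<close> H0 B0 by (simp_all add: field_simps)
  \<comment> \<open>\<open>\<sigma>\<close> takes finitely many values and is uniformly close to \<open>\<psi>\<close>, which equals \<open>\<phi>\<close> almost everywhere.\<close>
  define \<sigma> where "\<sigma> x = of_int \<lfloor>k * \<psi> x\<rfloor> / real k" for x
  define A where "A j = {x \<in> space M. \<lfloor>k * \<psi> x\<rfloor> = j}" for j :: int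
  have A: "A j \<in> sets M" for j unfolding A_def by measurable
  define J where "J = {\<lfloor>- (k * D)\<rfloor>..\<lfloor>k * D\<rfloor>}"
  have J: "finite J" by (simp add: J_def)
  have \<sigma>_sum: "\<sigma> x = (\<Sum>j\<in>J. of_int j / k * indicator (A j) x)" if "x \<in> space M" for x
  proof -
    have "real k * (- D) \<le> real k * \<psi> x" "real k * \<psi> x \<le> real k * D"
      by (intro mult_left_mono \<psi>D of_nat_0_le_iff)+
    then have "\<lfloor>k * \<psi> x\<rfloor> \<in> J" unfolding J_def by (auto intro!: floor_mono)
    then have "(\<Sum>j\<in>J. of_int j / k * indicator (A j) x) = (\<Sum>j\<in>{\<lfloor>k * \<psi> x\<rfloor>}. of_int j / real k * indicator (A j) x)"
      using J by (intro sum.mono_neutral_right) (auto simp: A_def)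
    then show ?thesis using that by (simp add: \<sigma>_def A_def)
  qed
  have \<sigma>\<psi>: "\<bar>\<psi> x - \<sigma> x\<bar> \<le> 1 / k" for x
  proof -
    have "\<psi> x - \<sigma> x = (k * \<psi> x - of_int \<lfloor>k * \<psi> x\<rfloor>) / k"
      using k0 by (simp add: \<sigma>_def field_simps)
    moreover have "\<bar>k * \<psi> x - of_int \<lfloor>k * \<psi> x\<rfloor>\<bar> \<le> 1" by linarith
    ultimately show ?thesis using k0 by (simp add: divide_right_mono)
  qed
  have iA: "integrable M (\<lambda>x. indicator (A j) x * f x)" if "integrable M f" for f :: "'a \<Rightarrow> real" and j
    using integrable_mult_indicator[OF A that] by simp
  have \<sigma>_int: "integrable M (\<lambda>x. f x * \<sigma> x)"
      "(LINT x|M. f x * \<sigma> x) = (\<Sum>j\<in>J. of_int j / k * (LINT x|M. indicator (A j) x * f x))"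
    if f: "integrable M f" for f
  proof -
    have eq: "f x * \<sigma> x = (\<Sum>j\<in>J. of_int j / k * (indicator (A j) x * f x))" if "x \<in> space M" for x
      by (simp add: \<sigma>_sum[OF that] sum_distrib_left mult_ac)
    have "integrable M (\<lambda>x. \<Sum>j\<in>J. of_int j / k * (indicator (A j) x * f x))"
      by (intro Bochner_Integration.integrable_sum integrable_mult_right iA f)
    then show "integrable M (\<lambda>x. f x * \<sigma> x)"
      by (rule Bochner_Integration.integrable_cong[THEN iffD2, rotated -1]) (simp_all add: eq)
    have "(LINT x|M. f x * \<sigma> x) = (LINT x|M. (\<Sum>j\<in>J. of_int j / k * (indicator (A j) x * f x)))"
      by (intro Bochner_Integration.integral_cong refl eq)
    also have "\<dots> = (\<Sum>j\<in>J. of_int j / k * (LINT x|M. indicator (A j) x * f x))"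
      by (subst Bochner_Integration.integral_sum)
        (intro integrable_mult_right iA f, intro sum.cong refl integral_mult_right_zero)
    finally show "(LINT x|M. f x * \<sigma> x) = (\<Sum>j\<in>J. of_int j / k * (LINT x|M. indicator (A j) x * f x))" .
  qed
  have close: "\<bar>(LINT x|M. f x * \<phi> x) - (LINT x|M. f x * \<sigma> x)\<bar> \<le> (LINT x|M. \<bar>f x\<bar>) / k"
    if f: "integrable M f" for f
  proof -
    have "integrable M (\<lambda>x. f x * \<psi> x)"
    proof (rule Bochner_Integration.integrable_bound)
      show "integrable M (\<lambda>x. D * f x)" using f by simp
      show "AE x in M. norm (f x * \<psi> x) \<le> norm (D * f x)"
        using \<psi>D D by (auto simp: abs_mult abs_le_iff mult.commute[of D] intro!: AE_I2 mult_left_mono)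
           (metis minus_le_iff)
    qed (use f in auto)
    note i = this \<sigma>_int(1)[OF f]
    have "(LINT x|M. f x * \<phi> x) = (LINT x|M. f x * \<psi> x)"
      using \<phi>\<psi> f \<phi>(1) by (intro integral_cong_AE) auto
    then have "\<bar>(LINT x|M. f x * \<phi> x) - (LINT x|M. f x * \<sigma> x)\<bar> = \<bar>LINT x|M. f x * \<psi> x - f x * \<sigma> x\<bar>"
      using i by simp
    also have "\<dots> \<le> (LINT x|M. \<bar>f x * \<psi> x - f x * \<sigma> x\<bar>)" by (rule integral_abs_bound)
    also have "\<dots> \<le> (LINT x|M. \<bar>f x\<bar> / k)"
    proof (rule integral_mono)
      fix x
      have "\<bar>f x * \<psi> x - f x * \<sigma> x\<bar> = \<bar>f x\<bar> * \<bar>\<psi> x - \<sigma> x\<bar>"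
        by (simp add: abs_mult[symmetric] right_diff_distrib)
      also have "\<dots> \<le> \<bar>f x\<bar> * (1 / k)" by (intro mult_left_mono \<sigma>\<psi>) simp
      finally show "\<bar>f x * \<psi> x - f x * \<sigma> x\<bar> \<le> \<bar>f x\<bar> / k" by simp
    qed (use i f in auto)
    finally show ?thesis by simp
  qed
  have "(\<lambda>l. LINT x|M. g l x * \<sigma> x) \<longlonglongrightarrow> (LINT x|M. h x * \<sigma> x)"
    unfolding \<sigma>_int(2)[OF g] \<sigma>_int(2)[OF h]
    by (intro tendsto_intros conv A)
  then have "\<forall>\<^sub>F l in sequentially. dist (LINT x|M. g l x * \<sigma> x) (LINT x|M. h x * \<sigma> x) < \<epsilon> / 3"
    by (rule tendstoD) (use \<open>\<epsilon> > 0\<close> in simp)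
  then show "\<forall>\<^sub>F l in sequentially. dist (LINT x|M. g l x * \<phi> x) (LINT x|M. h x * \<phi> x) < \<epsilon>"
  proof eventually_elim
    case (elim l)
    have "\<bar>(LINT x|M. g l x * \<phi> x) - (LINT x|M. g l x * \<sigma> x)\<bar> < \<epsilon> / 3"
      using close[OF g] divide_right_mono[OF B of_nat_0_le_iff] kB
      by (rule le_less_trans[OF order_trans])
    moreover have "\<bar>(LINT x|M. h x * \<phi> x) - (LINT x|M. h x * \<sigma> x)\<bar> < \<epsilon> / 3"
      using close[OF h] kH unfolding H_def by (rule le_less_trans)
    ultimately show ?case using elim unfolding dist_real_def by linarith
  qed
qed

section \<open>Borel versus Lebesgue measurability on K, and linearity of the embedding\<close>

text \<open>Completing a measure does not change integrals of functions measurable before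
  completion. This transfers a density found on the Borel sets to
  \<open>lebesgue_on K\<close>.\<close>

lemma integral_restrict_lborel:
  fixes K :: "'a::euclidean_space set"
  assumes K: "K \<in> sets borel" and h: "h \<in> borel_measurable (restrict_space lborel K)"
  shows "integrable (lebesgue_on K) h \<longleftrightarrow> integrable (restrict_space lborel K) h" (is ?int)
    and "(LINT x|lebesgue_on K. h x) = (LINT x|restrict_space lborel K. h x :: real)"
proof -
  have m: "(\<lambda>x. indicator K x *\<^sub>R h x) \<in> borel_measurable lborel"
    using h K by (subst (asm) borel_measurable_restrict_space_iff) simp_all
  show ?int
    using K by (simp add: integrable_restrict_space integrable_completion[OF m, simplified])
  show "(LINT x|lebesgue_on K. h x) = (LINT x|restrict_space lborel K. h x)"
    using K by (simp add: integral_restrict_space integral_completion[OF m, simplified])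
qed

text \<open>The Borel main part of a Lebesgue set differs from it by a null set. Being a subset of
  \<open>A\<close>, it stays inside \<open>K\<close>.\<close>

lemma lebesgue_on_borel_part:
  fixes K :: "'a::euclidean_space set"
  assumes K: "K \<in> sets borel" and A: "A \<in> sets (lebesgue_on K)"
  obtains A' where "A' \<in> sets (borel_on K)" "AE x in lebesgue_on K. x \<in> A' \<longleftrightarrow> x \<in> A"
proof -
  have KL: "K \<in> sets lebesgue" using K by simp
  have AL: "A \<in> sets lebesgue" "A \<subseteq> K" using A KL by (auto simp: sets_restrict_space_iff)
  have "main_part lborel A \<subseteq> K"
    using main_part_null_part_Un[OF AL(1)] AL(2) by blast
  then have "main_part lborel A \<in> sets (borel_on K)"
    using main_part_sets[OF AL(1)] K by (simp add: sets_restrict_space_iff)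
  moreover have "AE x in lebesgue_on K. x \<in> main_part lborel A \<longleftrightarrow> x \<in> A"
    using AE_completion[OF AE_in_main_part[OF AL(1)]] KL
    by (subst AE_restrict_space_iff) (auto elim!: eventually_mono)
  ultimately show thesis by (rule that)
qed

lemma density_set_function_linear:
  fixes K :: "'a::euclidean_space set"
  assumes f: "integrable (lebesgue_on K) f"
  shows "density_set_function K (\<lambda>x. c * f x) = (\<lambda>A. c * density_set_function K f A)"
    and "integrable (lebesgue_on K) g \<Longrightarrow>
      density_set_function K (\<lambda>x. f x + g x) = (\<lambda>A. density_set_function K f A + density_set_function K g A)"
proof -
  have i: "integrable (lebesgue_on K) (\<lambda>x. indicator A x * f x)"
    if "integrable (lebesgue_on K) f" "A \<in> sets (borel_on K)" for f :: "'a \<Rightarrow> real" and A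
    using integrable_mult_indicator[OF sets_borel_on_imp_lebesgue_on[OF that(2)] that(1)] by simp
  show "density_set_function K (\<lambda>x. c * f x) = (\<lambda>A. c * density_set_function K f A)"
    by (simp add: density_set_function_def fun_eq_iff mult.left_commute[of _ c])
  show "density_set_function K (\<lambda>x. f x + g x) = (\<lambda>A. density_set_function K f A + density_set_function K g A)"
    if "integrable (lebesgue_on K) g"
    using i[OF f] i[OF that] by (auto simp: density_set_function_def fun_eq_iff distrib_left)
qed

section \<open>The two implications between the weak convergences\<close>

lemma weakly_converges_L1_imp_rca:
  fixes K :: "'a::euclidean_space set"
  assumes K: "compact K" and conv: "weakly_converges_L1 K g h"
  shows "weakly_converges_rca K (\<lambda>l. density_set_function K (g l)) (density_set_function K h)"
proof -
  have KB: "K \<in> sets borel" using K by (simp add: borel_compact)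
  interpret finite_measure "lebesgue_on K"
    by (rule finite_measure_lebesgue_on[OF lmeasurable_compact[OF K]])
  have g: "integrable (lebesgue_on K) (g l)" and h: "integrable (lebesgue_on K) h" for l
    using conv by (auto simp: weakly_converges_L1_def L1_def)
  note rca = density_set_function_rca[OF KB]
  have "(\<lambda>l. F (density_set_function K (g l))) \<longlonglongrightarrow> F (density_set_function K h)"
    if F: "F \<in> rca_dual K" for F
  proof -
    obtain C where C: "\<And>\<mu>. \<mu> \<in> rca K \<Longrightarrow> \<bar>F \<mu>\<bar> \<le> C * rca_norm K \<mu>"
      using F unfolding rca_dual_def by blast
    \<comment> \<open>The sign of \<open>C\<close> is unknown; \<open>max C 0\<close> allows the
      norm estimate for the embedding to be multiplied by it.\<close>
    obtain \<phi> where \<phi>: "\<phi> \<in> borel_measurable (lebesgue_on K)" "AE x in lebesgue_on K. \<bar>\<phi> x\<bar> \<le> max C 0"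
      and F\<phi>: "\<And>f. integrable (lebesgue_on K) f \<Longrightarrow>
        F (density_set_function K f) = (LINT x|lebesgue_on K. f x * \<phi> x)"
    proof (rule L1_functional_eq_integral[of "\<lambda>f. F (density_set_function K f)" "max C 0"])
      fix f :: "'a \<Rightarrow> real" assume f: "integrable (lebesgue_on K) f"
      show "F (density_set_function K (\<lambda>x. c * f x)) = c * F (density_set_function K f)" for c
        using F rca(1)[OF f] by (simp add: density_set_function_linear(1)[OF f] rca_dual_def)
      show "F (density_set_function K (\<lambda>x. f x + g x)) = F (density_set_function K f) + F (density_set_function K g)"
        if "integrable (lebesgue_on K) g" for g :: "'a \<Rightarrow> real"
        using F rca(1)[OF f] rca(1)[OF that]
        by (simp add: density_set_function_linear(2)[OF f that] rca_dual_def)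
      have "\<bar>F (density_set_function K f)\<bar> \<le> max C 0 * rca_norm K (density_set_function K f)"
        by (rule order_trans[OF C[OF rca(1)[OF f]]]) (simp add: mult_right_mono rca_norm_def)
      also have "\<dots> \<le> max C 0 * (LINT x|lebesgue_on K. \<bar>f x\<bar>)"
        by (intro mult_left_mono rca(2) f) simp
      finally show "\<bar>F (density_set_function K f)\<bar> \<le> max C 0 * (LINT x|lebesgue_on K. \<bar>f x\<bar>)" .
    qed blast
    have "\<phi> \<in> Linfty K" using \<phi> by (auto simp: Linfty_def)
    then show ?thesis
      using conv by (simp add: F\<phi>[OF g] F\<phi>[OF h] weakly_converges_L1_def)
  qed
  then show ?thesis
    using rca(1)[OF g] rca(1)[OF h] by (simp add: weakly_converges_rca_def)
qed

text \<open>The limit \<open>\<eta>\<close> is controlled only on Borel sets, whereas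
  \<open>L1 K\<close> and \<open>Linfty K\<close> use Lebesgue measurability. So the density is
  found for Borel Lebesgue measure, and convergence is then extended to Lebesgue sets by changing
  them on null sets.\<close>

lemma weakly_converges_rca_imp_L1:
  fixes K :: "'a::euclidean_space set"
  assumes K: "compact K"
    and g: "\<And>l. integrable (lebesgue_on K) (g l)" and nonneg: "\<And>l y. y \<in> K \<Longrightarrow> 0 \<le> g l y"
    and conv: "weakly_converges_rca K (\<lambda>l. density_set_function K (g l)) \<eta>"
  obtains h where "weakly_converges_L1 K g h"
proof -
  have KB: "K \<in> sets borel" using K by (simp add: borel_compact)
  have KBK: "K \<in> sets (borel_on K)" using KB by (simp add: sets_restrict_space_iff)
  let ?R = "restrict_space lborel K"
  have sets_R: "sets ?R = sets (borel_on K)" by (simp cong: sets_restrict_space_cong)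
  have \<eta>: "\<eta> \<in> rca K" using conv by (simp add: weakly_converges_rca_def)
  have lim: "(\<lambda>l. density_set_function K (g l) A) \<longlonglongrightarrow> \<eta> A" for A
    using conv eval_in_rca_dual[of A K] unfolding weakly_converges_rca_def by fast
  interpret R: finite_measure ?R
    using emeasure_compact_finite[OF K] KB
    by (intro finite_measureI) (simp add: emeasure_restrict_space)
  obtain h where h: "integrable ?R h" and \<eta>h: "\<And>A. A \<in> sets ?R \<Longrightarrow> \<eta> A = (LINT x|?R. indicator A x * h x)"
  proof (rule R.density_of_countably_additive[of \<eta>])
    show "0 \<le> \<eta> A" for A
      by (rule LIMSEQ_le_const[OF lim])
        (auto simp: density_set_function_def indicator_def intro!: exI[of _ 0] Bochner_Integration.integral_nonneg nonneg)
    \<comment> \<open>Absolute continuity survives setwise limits: every member of the sequence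
      vanishes on \<open>A\<close>, so its limit does too.\<close>
    show "\<eta> A = 0" if "A \<in> null_sets ?R" for A
    proof (rule LIMSEQ_unique[OF lim])
      have "A \<in> null_sets lborel" "A \<subseteq> K" using that KB by (auto simp: null_sets_restrict_space)
      then have "A \<in> null_sets lebesgue" by (simp add: null_sets_completionI)
      then have "AE x in lebesgue. x \<notin> A" by (rule AE_not_in)
      then have "AE x in lebesgue_on K. x \<notin> A" using KB by (subst AE_restrict_space_iff) auto
      then have "(LINT x|lebesgue_on K. indicator A x * g l x) = 0" for l
        by (intro integral_eq_zero_AE) (auto elim!: eventually_mono)
      then show "(\<lambda>l. density_set_function K (g l) A) \<longlonglongrightarrow> 0"
        by (simp add: density_set_function_def cong: if_cong)
    qed
    show "(\<lambda>i. \<eta> (A i)) sums \<eta> (\<Union>i. A i)"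
      if "range A \<subseteq> sets ?R" "disjoint_family A" for A :: "nat \<Rightarrow> 'a set"
      using \<eta> that unfolding sets_R rca_def signed_countably_additive_def by blast
  qed blast
  have hL: "integrable (lebesgue_on K) h"
    using h integral_restrict_lborel(1)[OF KB borel_measurable_integrable[OF h]] by simp
  have conv_A: "(\<lambda>l. LINT x|lebesgue_on K. indicator A x * g l x)
      \<longlonglongrightarrow> (LINT x|lebesgue_on K. indicator A x * h x)"
    if A: "A \<in> sets (lebesgue_on K)" for A
  proof -
    obtain A' where A': "A' \<in> sets (borel_on K)" and eq: "AE x in lebesgue_on K. x \<in> A' \<longleftrightarrow> x \<in> A"
      using lebesgue_on_borel_part[OF KB A] .
    note A'L = sets_borel_on_imp_lebesgue_on[OF A']
    have AA': "(LINT x|lebesgue_on K. indicator A x * f x) = (LINT x|lebesgue_on K. indicator A' x * f x)"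
      if f: "integrable (lebesgue_on K) f" for f :: "'a \<Rightarrow> real"
      using f A A'L eq by (intro integral_cong_AE) (auto simp: indicator_def elim!: eventually_mono)
    have "(\<lambda>x. indicator A' x * h x) \<in> borel_measurable ?R"
      using integrable_mult_indicator[of A' ?R h] A' h by (simp add: sets_R)
    then have "\<eta> A' = (LINT x|lebesgue_on K. indicator A' x * h x)"
      using \<eta>h[of A'] A' by (simp add: sets_R integral_restrict_lborel(2)[OF KB])
    then show ?thesis
      using lim[of A'] A' by (simp add: AA'[OF g] AA'[OF hL] density_set_function_def)
  qed
  \<comment> \<open>By nonnegativity the L1 norms are the masses of \<open>K\<close>. These
    converge, hence are bounded, which supplies \<open>B\<close>.\<close>
  have abs_g: "(LINT x|lebesgue_on K. \<bar>g l x\<bar>) = density_set_function K (g l) K" for l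
    using KBK nonneg by (auto simp: density_set_function_def intro!: Bochner_Integration.integral_cong)
  obtain B where B: "\<And>l. \<bar>density_set_function K (g l) K\<bar> \<le> B"
    using convergent_imp_Bseq[OF convergentI[OF lim[of K]]] by (auto simp: Bseq_def)
  have "(LINT x|lebesgue_on K. \<bar>g l x\<bar>) \<le> B" for l using B[of l] abs_g[of l] by simp
  from integral_bounded_mult_tendsto[OF g hL this conv_A]
  show thesis
    using g hL by (intro that[of h]) (auto simp: weakly_converges_L1_def L1_def Linfty_def)
qed

section \<open>The densities of the Young measures and the equivalence\<close>

text \<open>The determinant is a polynomial in the matrix entries, hence continuous on the open
  image. Extension by 0 off an open set keeps it Borel.\<close>

lemma borel_measurable_inverse_Jacobian:
  assumes "open (v ` D)" and "continuously_differentiable_on (the_inv_into D v) (v ` D)"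
  shows "inverse_Jacobian D v \<in> borel_measurable borel"
proof -
  have J: "continuous_on (v ` D) (\<lambda>y. jacobian (the_inv_into D v) (at y))"
    using assms(2) by (simp add: continuously_differentiable_on_def)
  have "continuous_on (v ` D) (\<lambda>y. det (jacobian (the_inv_into D v) (at y)))"
    unfolding det_def by (intro continuous_intros J)
  then have "(\<lambda>y. indicator (v ` D) y *\<^sub>R det (jacobian (the_inv_into D v) (at y))) \<in> borel_measurable borel"
    using assms(1) by (intro borel_measurable_continuous_on_indicator) auto
  also have "(\<lambda>y. indicator (v ` D) y *\<^sub>R det (jacobian (the_inv_into D v) (at y))) = inverse_Jacobian D v"
    by (auto simp: inverse_Jacobian_def fun_eq_iff)
  finally show ?thesis .
qed

text \<open>The finite mass of \<open>K\<close> makes \<open>g\<close> integrable, and nonnegativity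
  lets the extended nonnegative integrals be read as real ones.\<close>

lemma measure_eq_density_set_function:
  fixes K :: "'a::euclidean_space set"
  assumes K: "K \<in> sets borel" and N: "finite_measure N" "sets N = sets (borel_on K)"
    and meas: "g \<in> borel_measurable (lebesgue_on K)" and nonneg: "\<And>y. y \<in> K \<Longrightarrow> 0 \<le> g y"
    and density: "\<And>A. A \<in> sets (borel_on K) \<Longrightarrow>
      emeasure N A = (\<integral>\<^sup>+ y\<in>A. ennreal (g y) \<partial>lebesgue)"
  shows "integrable (lebesgue_on K) g" and "measure N = density_set_function K g"
proof -
  interpret finite_measure N by fact
  have KBK: "K \<in> sets (borel_on K)" using K by (simp add: sets_restrict_space_iff)
  have em: "emeasure N A = (\<integral>\<^sup>+ y. ennreal (indicator A y * g y) \<partial>lebesgue_on K)"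
    if A: "A \<in> sets (borel_on K)" for A
  proof -
    have "A \<subseteq> K" using A K by (simp add: sets_restrict_space_iff)
    then have "(\<integral>\<^sup>+ y. ennreal (indicator A y * g y) \<partial>lebesgue_on K) = (\<integral>\<^sup>+ y\<in>A. ennreal (g y) \<partial>lebesgue)"
      using K by (subst nn_integral_restrict_space) (auto intro!: nn_integral_cong simp: indicator_def)
    then show ?thesis using density[OF A] by simp
  qed
  show int: "integrable (lebesgue_on K) g"
  proof (rule integrableI_nonneg)
    have "(\<integral>\<^sup>+ y. ennreal (g y) \<partial>lebesgue_on K) = emeasure N K"
      unfolding em[OF KBK] by (intro nn_integral_cong) simp
    also have "\<dots> < \<infinity>" using emeasure_finite[of K] by (simp add: less_top[symmetric])
    finally show "(\<integral>\<^sup>+ y. ennreal (g y) \<partial>lebesgue_on K) < \<infinity>" .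
  qed (use meas nonneg in auto)
  show "measure N = density_set_function K g"
  proof
    fix A
    show "measure N A = density_set_function K g A"
    proof (cases "A \<in> sets (borel_on K)")
      case True
      have i: "integrable (lebesgue_on K) (\<lambda>y. indicator A y * g y)"
        using integrable_mult_indicator[OF sets_borel_on_imp_lebesgue_on[OF True] int] by simp
      have "AE y in lebesgue_on K. 0 \<le> indicator A y * g y"
        using nonneg by (auto simp: indicator_def)
      then show ?thesis
        using True i
        by (simp add: measure_def em[OF True] density_set_function_def nn_integral_eq_integral[OF i]
            integral_nonneg_AE)
    next
      case False
      then show ?thesis
        using N(2) by (simp add: density_set_function_def measure_notin_sets)
    qed
  qed
qed

theorem theorem4p3:
  fixes \<Omega> K :: "(real^'n) set"
    and M :: real
    and n :: "nat \<Rightarrow> nat"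
    and \<Omega>s :: "nat \<Rightarrow> nat \<Rightarrow> (real^'n) set"
    and us :: "nat \<Rightarrow> nat \<Rightarrow> real^'n \<Rightarrow> real^'n"
    and u :: "nat \<Rightarrow> real^'n \<Rightarrow> real^'n"
    and g :: "nat \<Rightarrow> real^'n \<Rightarrow> real"
    and \<nu> :: "nat \<Rightarrow> (real^'n) measure"
  assumes "open \<Omega>" and "emeasure lebesgue \<Omega> = ennreal M" and "M > 0"
    and "compact K"
    and "\<And>l i. i \<in> {1..n l} \<Longrightarrow> open (\<Omega>s l i) \<and> \<Omega>s l i \<subseteq> \<Omega>"
    and "\<And>l. disjoint_family_on (\<Omega>s l) {1..n l}"
    and "\<And>l. (\<Union>i\<in>{1..n l}. closure (\<Omega>s l i)) = closure \<Omega>"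
    and "\<And>l i. i \<in> {1..n l} \<Longrightarrow> us l i ` \<Omega>s l i \<subseteq> K"
    and "\<And>l i. i \<in> {1..n l} \<Longrightarrow> inj_on (us l i) (\<Omega>s l i)"
    and "\<And>l i. i \<in> {1..n l} \<Longrightarrow> open (us l i ` \<Omega>s l i)"
    and "\<And>l i. i \<in> {1..n l} \<Longrightarrow>
           continuously_differentiable_on (the_inv_into (\<Omega>s l i) (us l i)) (us l i ` \<Omega>s l i)"
    and "\<And>l i. i \<in> {1..n l} \<Longrightarrow> closure (us l i ` \<Omega>s l i) = K"
    and "\<And>l x. u l x = (\<Sum>i\<in>{1..n l}. indicator (\<Omega>s l i) x *\<^sub>R us l i x)"
    and "\<And>l y. y \<in> K \<Longrightarrow>
           g l y = (1 / M) * (\<Sum>i\<in>{1..n l}. \<bar>inverse_Jacobian (\<Omega>s l i) (us l i) y\<bar>)"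
    and "\<And>l. homogeneous_Young_measure \<Omega> K (u l) (\<nu> l)"
    and "\<And>l A. A \<in> sets (borel_on K) \<Longrightarrow>
           emeasure (\<nu> l) A = (\<integral>\<^sup>+ y\<in>A. ennreal (g l y) \<partial>lebesgue)"
  shows "(\<exists>h. weakly_converges_L1 K g h) \<longleftrightarrow>
         (\<exists>\<eta>. weakly_converges_rca K (\<lambda>l. measure (\<nu> l)) \<eta>)"
proof -
  note open_image = assms(10) and C1 = assms(11) and g_eq = assms(14)
    and young = assms(15) and density = assms(16)
  have KB: "K \<in> sets borel" using \<open>compact K\<close> by (simp add: borel_compact)
  \<comment> \<open>The function \<open>g l\<close> is prescribed only on \<open>K\<close>, so
    measurability is shown for the formula on the whole space and then restricted.\<close>
  have meas: "g l \<in> borel_measurable (lebesgue_on K)" for l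
  proof -
    have "(\<lambda>y. (1 / M) * (\<Sum>i\<in>{1..n l}. \<bar>inverse_Jacobian (\<Omega>s l i) (us l i) y\<bar>)) \<in> borel_measurable borel"
      by (intro borel_measurable_times borel_measurable_const borel_measurable_sum borel_measurable_abs
          borel_measurable_inverse_Jacobian open_image C1)
    then have "(\<lambda>y. (1 / M) * (\<Sum>i\<in>{1..n l}. \<bar>inverse_Jacobian (\<Omega>s l i) (us l i) y\<bar>))
        \<in> borel_measurable (lebesgue_on K)"
      by (intro measurable_restrict_space1 measurable_completion) simp
    then show ?thesis
      by (rule measurable_cong[THEN iffD2, rotated]) (simp add: g_eq)
  qed
  have nonneg: "0 \<le> g l y" if "y \<in> K" for l y
    using \<open>M > 0\<close> by (simp add: g_eq[OF that] sum_nonneg)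
  have \<nu>: "finite_measure (\<nu> l)" "sets (\<nu> l) = sets (borel_on K)" for l
    using young[of l] by (auto simp: homogeneous_Young_measure_def prob_space_def)
  \<comment> \<open>After this identification of \<open>\<nu> l\<close> with the image of
    \<open>g l\<close>, both sides of the equivalence speak of \<open>g\<close> alone.\<close>
  have \<nu>_density: "integrable (lebesgue_on K) (g l)" "measure (\<nu> l) = density_set_function K (g l)" for l
    using nonneg density[of _ l] by (auto intro: measure_eq_density_set_function[OF KB \<nu>[of l] meas])
  show ?thesis
    unfolding \<nu>_density(2)
  proof
    assume "\<exists>h. weakly_converges_L1 K g h"
    then show "\<exists>\<eta>. weakly_converges_rca K (\<lambda>l. density_set_function K (g l)) \<eta>"
      using weakly_converges_L1_imp_rca[OF \<open>compact K\<close>] by blast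
  next
    assume "\<exists>\<eta>. weakly_converges_rca K (\<lambda>l. density_set_function K (g l)) \<eta>"
    then obtain \<eta> where \<eta>: "weakly_converges_rca K (\<lambda>l. density_set_function K (g l)) \<eta>" ..
    obtain h where "weakly_converges_L1 K g h"
      using weakly_converges_rca_imp_L1[OF \<open>compact K\<close> \<nu>_density(1) _ \<eta>] nonneg by blast
    then show "\<exists>h. weakly_converges_L1 K g h" by blast
  qed
qed

end
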